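(* Let $\chi,\chi':\mathbb{R}^{2d}\to\mathbb{R}^{2d}$ be two tame canonical transformations such that $$\lim_{|\eta|\to+\infty}\frac{|\chi(0,\eta)-\chi'(0,\eta)|}{|\eta|}=0.$$ If $\chi$ satisfies the vertical nonrefocusing condition, then $\chi'$ also satisfies the vertical nonrefocusing condition.
   Context: A tame canonical transformation is a smooth map $\chi:\mathbb{R}^{2d}\to\mathbb{R}^{2d}$ such that (i) for every multi-index $\alpha$ with $|\alpha|\ge1$ there is a constant $C_\alpha$ with $|\partial^\alpha\chi(z)|\le C_\alpha$ for all $z\in\mathbb{R}^{2d}$; (ii) $\chi$ is canonical (symplectic): if $(x,\xi)=\chi(y,\eta)$ then $dy\wedge d\eta=dx\wedge d\xi$. (Such a map is a globally bi-Lipschitz diffeomorphism of $\mathbb{R}^{2d}$.) Vertical nonrefocusing condition for a map $\chi$: there exist an open conic neighborhood $\Gamma\subset\mathbb{R}^{2d}\setminus\{0\}$ of $\{0\}\times(\mathbb{R}^d\setminus\{0\})$ and $R>0$ such that, for $\eta\in\mathbb{R}^d$, $|\eta|>R$ implies $\chi(0,\eta)\notin\Gamma$. (Conic means invariant under multiplication by positive scalars.) *)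

theory Defs
  imports "HOL-Analysis.Analysis"
begin

definition partial_deriv ::
    "'a::euclidean_space \<Rightarrow> ('a \<Rightarrow> 'b::real_normed_vector) \<Rightarrow> 'a \<Rightarrow> 'b"
  where "partial_deriv e f z = frechet_derivative f (at z) e"

(* Higher partial derivatives are indexed by lists of coordinate directions (elements of Basis):
   a list es stands for the multi-index counting the occurrences of each direction, and its
   length is the order of that multi-index.  For smooth f the order of the entries is irrelevant. *)
primrec iter_partial ::
    "'a::euclidean_space list \<Rightarrow> ('a \<Rightarrow> 'b::real_normed_vector) \<Rightarrow> 'a \<Rightarrow> 'b"
  where
    "iter_partial [] f = f"
  | "iter_partial (e # es) f = partial_deriv e (iter_partial es f)"

definition smooth_map :: "('a::euclidean_space \<Rightarrow> 'b::real_normed_vector) \<Rightarrow> bool"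
  where "smooth_map f \<longleftrightarrow>
    (\<forall>es. set es \<subseteq> Basis \<longrightarrow> (\<forall>z. iter_partial es f differentiable (at z)))"

(* The value of the two-form dy \<and> d\<eta> = (\<Sum>j. dy_j \<and> d\<eta>_j) on a pair of tangent vectors, where points
   of the phase space are written (y, \<eta>). *)
definition symplectic_form :: "(real^'n) \<times> (real^'n) \<Rightarrow> (real^'n) \<times> (real^'n) \<Rightarrow> real"
  where "symplectic_form u v = fst u \<bullet> snd v - fst v \<bullet> snd u"

definition canonical_map :: "((real^'n) \<times> (real^'n) \<Rightarrow> (real^'n) \<times> (real^'n)) \<Rightarrow> bool"
  where "canonical_map chi \<longleftrightarrow>
    (\<forall>z u v. symplectic_form (frechet_derivative chi (at z) u) (frechet_derivative chi (at z) v)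
             = symplectic_form u v)"

definition tame_canonical :: "((real^'n) \<times> (real^'n) \<Rightarrow> (real^'n) \<times> (real^'n)) \<Rightarrow> bool"
  where "tame_canonical chi \<longleftrightarrow>
    smooth_map chi \<and>
    (\<forall>es. set es \<subseteq> Basis \<and> length es \<ge> 1 \<longrightarrow> (\<exists>C. \<forall>z. norm (iter_partial es chi z) \<le> C)) \<and>
    canonical_map chi"

(* Not the library's conic, which also demands closure under multiplication by 0. *)
definition pos_conic :: "'a::real_vector set \<Rightarrow> bool"
  where "pos_conic S \<longleftrightarrow> (\<forall>x\<in>S. \<forall>c>0. c *\<^sub>R x \<in> S)"

definition vertical_nonrefocusing ::
    "((real^'n) \<times> (real^'n) \<Rightarrow> (real^'n) \<times> (real^'n)) \<Rightarrow> bool"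
  where "vertical_nonrefocusing chi \<longleftrightarrow>
    (\<exists>\<Gamma> R. open \<Gamma> \<and> pos_conic \<Gamma> \<and> \<Gamma> \<subseteq> UNIV - {0} \<and> {0} \<times> (UNIV - {0}) \<subseteq> \<Gamma> \<and> R > 0 \<and>
           (\<forall>\<eta>. norm \<eta> > R \<longrightarrow> chi (0, \<eta>) \<notin> \<Gamma>))"

end

theory Submission
  imports Defs
begin

text \<open>
  The condition says that the directions of \<open>\<chi>(0, \<eta>)\<close>, for large \<open>\<eta>\<close>, stay away from the vertical
  directions \<open>(0, \<xi>)\<close>.  By compactness of the unit sphere the cone \<open>\<Gamma>\<close> contains a cone
  \<open>{z. \<exists>\<xi>. |z - (0, \<xi>)| < \<delta> |\<xi>|}\<close>.  If \<open>\<chi>'(0, \<eta>)\<close> lay in the corresponding cone with a smaller aperture,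
  then \<open>\<chi>(0, \<eta>)\<close>, which differs from it by \<open>o(|\<eta>|)\<close>, would lie in \<open>\<Gamma>\<close>, \<^emph>\<open>provided\<close> that \<open>|\<eta>|\<close> is
  controlled by \<open>|\<chi>'(0, \<eta>)|\<close>.

  That control is the only real point, and it is where tameness enters.  Preservation of the
  symplectic form gives \<open>|D\<chi>'(z) u| \<ge> |u| / M\<close>, with \<open>M\<close> a bound for the first derivatives; together
  with bounded second derivatives this makes \<open>\<chi>'\<close> expand distances by a fixed factor at some fixed
  scale (\<open>tame_canonical_locally_expanding\<close>).  A continuous self-map of Euclidean space which expands
  uniformly at a fixed scale is a covering map; the target being simply connected, it is injective,
  and the expansion estimate then holds at all distances (\<open>locally_expanding_imp_expanding\<close>, a metric
  form of Hadamard's global inverse function theorem).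
\<close>

section \<open>Maps that expand distances at a fixed scale\<close>

text \<open>
  The image of the open ball is open by invariance of domain, and no boundary point of the ball is
  mapped into the ball around \<open>f z\<close>; so the image is open and closed relative to that connected set.
\<close>

lemma locally_expanding_ball_subset_image:
  fixes f :: "'a::euclidean_space \<Rightarrow> 'a"
  assumes cont: "continuous_on UNIV f" and "0 < c"
    and expand: "\<And>a b. dist a b \<le> r \<Longrightarrow> c * dist a b \<le> dist (f a) (f b)"
    and s: "0 < s" "2 * s \<le> r"
  shows "ball (f z) (c * s) \<subseteq> f ` ball z s"
proof -
  have inj: "inj_on f (ball z s)"
  proof (rule inj_onI)
    fix a b assume ab: "a \<in> ball z s" "b \<in> ball z s" "f a = f b"
    have "dist a b \<le> r"
      using ab s dist_triangle[of a b z] by (simp add: dist_commute)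
    from expand[OF this] ab \<open>0 < c\<close> show "a = b"
      by (simp add: mult_le_0_iff)
  qed
  have op: "open (f ` ball z s)"
    using invariance_of_domain[OF continuous_on_subset[OF cont] _ inj] by simp
  have cl: "closed (f ` cball z s)"
    by (intro compact_imp_closed compact_continuous_image continuous_on_subset[OF cont]) auto
  have inner: "f a \<in> f ` ball z s" if "a \<in> cball z s" "f a \<in> ball (f z) (c * s)" for a
  proof -
    have "c * dist z a \<le> dist (f z) (f a)"
      using that s by (intro expand) auto
    also have "\<dots> < c * s" using that by simp
    finally show ?thesis using \<open>0 < c\<close> by simp
  qed
  have "f ` ball z s \<inter> ball (f z) (c * s) = {} \<or> - (f ` cball z s) \<inter> ball (f z) (c * s) = {}"
  proof (rule connectedD[OF connected_ball op])
    show "open (- (f ` cball z s))" using cl by (rule open_Compl)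
    show "f ` ball z s \<inter> - f ` cball z s \<inter> ball (f z) (c * s) = {}"
      using ball_subset_cball by fastforce
    show "ball (f z) (c * s) \<subseteq> f ` ball z s \<union> - f ` cball z s"
      using inner by blast
  qed
  moreover have "f z \<in> f ` ball z s \<inter> ball (f z) (c * s)"
    using s \<open>0 < c\<close> by simp
  ultimately show ?thesis using inner by blast
qed

lemma locally_expanding_imp_surj:
  fixes f :: "'a::euclidean_space \<Rightarrow> 'a"
  assumes cont: "continuous_on UNIV f" and "0 < c" "0 < r"
    and expand: "\<And>a b. dist a b \<le> r \<Longrightarrow> c * dist a b \<le> dist (f a) (f b)"
  shows "range f = UNIV"
proof -
  have e: "0 < c * (r/2)" using assms by simp
  have sub: "ball (f z) (c * (r/2)) \<subseteq> range f" for z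
    using locally_expanding_ball_subset_image[OF cont \<open>0 < c\<close> expand, of r "r/2" z] \<open>0 < r\<close> by auto
  have "open (range f)"
    unfolding open_contains_ball using sub e by blast
  moreover have "open (- range f)"
    unfolding open_contains_ball
  proof
    fix y assume y: "y \<in> - range f"
    have "ball y (c * (r/2)) \<subseteq> - range f"
    proof
      fix w assume w: "w \<in> ball y (c * (r/2))"
      show "w \<in> - range f"
      proof
        assume "w \<in> range f"
        then obtain z where "w = f z" by blast
        then have "y \<in> ball (f z) (c * (r/2))" using w by (simp add: dist_commute)
        then show False using sub y by blast
      qed
    qed
    then show "\<exists>e>0. ball y e \<subseteq> - range f" using e by blast
  qed
  then have "closed (range f)" by (simp add: closed_def)
  ultimately show ?thesis
    using clopen[of "range f"] by auto
qed

text \<open>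
  The sheets over a small ball \<open>T\<close> around \<open>x\<close> are the pieces of the preimage of \<open>T\<close> near the points of
  the fibre over \<open>x\<close>.  The radius does not depend on the point of the fibre, so the sheets are
  disjoint and exhaust the preimage.
\<close>

lemma locally_expanding_imp_covering_space:
  fixes f :: "'a::euclidean_space \<Rightarrow> 'a"
  assumes cont: "continuous_on UNIV f" and "0 < c" "0 < r"
    and expand: "\<And>a b. dist a b \<le> r \<Longrightarrow> c * dist a b \<le> dist (f a) (f b)"
  shows "covering_space UNIV f UNIV"
proof (rule covering_spaceI[OF cont locally_expanding_imp_surj[OF assms]])
  fix x :: 'a
  define s where "s = r / 2"
  have s: "0 < s" "2 * s \<le> r" using \<open>0 < r\<close> by (auto simp: s_def)
  have sub: "ball (f z) (c * s) \<subseteq> f ` ball z s" for z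
    by (rule locally_expanding_ball_subset_image[OF cont \<open>0 < c\<close> expand s])
  have close: "a = b" if "dist a b \<le> r" "f a = f b" for a b
    using expand[OF that(1)] that(2) \<open>0 < c\<close> by (simp add: mult_le_0_iff)
  define T where "T = ball x (c * s)"
  define sheet where "sheet z = ball z s \<inter> f -` T" for z
  have open_sheet: "open (sheet z)" for z
    unfolding sheet_def T_def by (intro open_Int open_vimage cont open_ball)
  have disj: "z = z'" if "f z = x" "f z' = x" "a \<in> sheet z" "a \<in> sheet z'" for z z' a
  proof (rule close)
    show "dist z z' \<le> r"
      using that s dist_triangle[of z z' a] by (simp add: sheet_def dist_commute)
  qed (use that in auto)
  have homeo: "\<exists>q. homeomorphism (sheet z) T f q" if z: "f z = x" for z
  proof -
    have inj: "inj_on f (sheet z)"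
    proof (rule inj_onI)
      fix a b assume ab: "a \<in> sheet z" "b \<in> sheet z" "f a = f b"
      have "dist a b \<le> r"
        using ab s dist_triangle[of a b z] by (simp add: sheet_def dist_commute)
      then show "a = b" using ab close by blast
    qed
    have "f ` sheet z = T"
      using sub[of z] z unfolding sheet_def T_def by auto
    then show ?thesis
      using invariance_of_domain_homeomorphism[OF open_sheet continuous_on_subset[OF cont] _ inj]
      by (metis order_refl subset_UNIV)
  qed
  have union: "\<Union>(sheet ` (f -` {x})) = UNIV \<inter> f -` T"
  proof (intro equalityI subsetI)
    fix a assume "a \<in> UNIV \<inter> f -` T"
    then have "f a \<in> T" by simp
    then have "x \<in> ball (f a) (c * s)" by (simp add: T_def dist_commute)
    then obtain z where "z \<in> ball a s" "x = f z" using sub by blast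
    then show "a \<in> \<Union>(sheet ` (f -` {x}))"
      using \<open>f a \<in> T\<close> by (auto simp: sheet_def dist_commute)
  qed (auto simp: sheet_def)
  show "\<exists>T. x \<in> T \<and> openin (top_of_set UNIV) T \<and>
          (\<exists>v. \<Union>v = UNIV \<inter> f -` T \<and> (\<forall>u\<in>v. openin (top_of_set UNIV) u) \<and>
               pairwise disjnt v \<and> (\<forall>u\<in>v. \<exists>q. homeomorphism u T f q))"
  proof (intro exI conjI)
    show "x \<in> T" using s \<open>0 < c\<close> by (simp add: T_def)
    show "openin (top_of_set UNIV) T" by (simp add: T_def)
    show "\<Union>(sheet ` (f -` {x})) = UNIV \<inter> f -` T" by (rule union)
    show "\<forall>u\<in>sheet ` (f -` {x}). openin (top_of_set UNIV) u"
      using open_sheet by simp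
    show "pairwise disjnt (sheet ` (f -` {x}))"
      unfolding pairwise_def disjnt_iff using disj by blast
    show "\<forall>u\<in>sheet ` (f -` {x}). \<exists>q. homeomorphism u T f q"
      using homeo by blast
  qed
qed

text \<open>
  The identity of the base lifts through the covering to a section \<open>g\<close> with \<open>g (p a) = a\<close>, and
  \<open>g \<circ> p\<close> is the identity because both are lifts of \<open>p\<close> that agree at \<open>a\<close>.
\<close>

lemma covering_space_UNIV_imp_inj:
  fixes p :: "'a::real_normed_vector \<Rightarrow> 'b::real_normed_vector"
  assumes cov: "covering_space UNIV p UNIV"
  shows "inj p"
proof -
  have contp: "continuous_on UNIV p"
    using cov by (rule covering_space_imp_continuous)
  have sc: "simply_connected (UNIV :: 'b set)"
    by (simp add: convex_imp_simply_connected)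
  have lpc: "locally path_connected (UNIV :: 'b set)"
    by (simp add: convex_imp_locally_path_connected)
  obtain g where g: "continuous_on UNIV g" "g (p 0) = 0" "\<And>y. p (g y) = y"
    using covering_space_lift_strong[OF cov UNIV_I UNIV_I sc lpc continuous_on_id, of "p 0" 0]
    by auto
  have "g (p x) = x" for x
  proof (rule covering_space_lift_unique[OF cov, where a = 0 and f = p and T = UNIV])
    show "continuous_on UNIV (\<lambda>x. g (p x))"
      by (rule continuous_on_compose2[OF g(1) contp]) simp
  qed (use g contp in auto)
  then show ?thesis by (metis injI)
qed

text \<open>
  As \<open>f\<close> is a bijective covering map, the local estimate says that the inverse is Lipschitz with constant \<open>1 / c\<close> on
  balls of a fixed radius; dividing a segment in the target into short pieces makes this global.
\<close>

theorem locally_expanding_imp_expanding: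
  fixes f :: "'a::euclidean_space \<Rightarrow> 'a"
  assumes cont: "continuous_on UNIV f" and "0 < c" "0 < r"
    and expand: "\<And>a b. dist a b \<le> r \<Longrightarrow> c * dist a b \<le> dist (f a) (f b)"
  shows "c * dist a b \<le> dist (f a) (f b)"
proof -
  define s where "s = r / 2"
  have s: "0 < s" "2 * s \<le> r" using \<open>0 < r\<close> by (auto simp: s_def)
  have cs: "0 < c * s" using s \<open>0 < c\<close> by simp
  have inj: "inj f"
    using covering_space_UNIV_imp_inj locally_expanding_imp_covering_space[OF assms] by blast
  have step: "c * dist a b \<le> dist (f a) (f b)" if "dist (f a) (f b) < c * s" for a b
  proof -
    have "f b \<in> f ` ball a s"
      using that locally_expanding_ball_subset_image[OF cont \<open>0 < c\<close> expand s, of a] by auto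
    then have "b \<in> ball a s" by (simp only: inj_image_mem_iff[OF inj])
    then show ?thesis using s by (intro expand) simp
  qed
  have chain: "c * dist a b \<le> dist (f a) (f b)" if "dist (f a) (f b) < real n * (c * s)" for n a b
    using that
  proof (induction n arbitrary: a b)
    case 0
    then show ?case by simp
  next
    case (Suc n)
    define d where "d = dist (f a) (f b)"
    \<comment> \<open>Cut the segment from \<open>f a\<close> to \<open>f b\<close> so that the last piece has length \<open>d / (n + 1) < c s\<close>.\<close>
    define t where "t = real n / real (Suc n)"
    have t: "0 \<le> t" "t \<le> 1" "1 - t = 1 / real (Suc n)"
      by (auto simp: t_def field_simps)
    obtain m where m: "f m = f a + t *\<^sub>R (f b - f a)"
      using locally_expanding_imp_surj[OF assms] by (metis surjD)
    have d1: "dist (f a) (f m) = t * d"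
      using t by (simp add: m d_def dist_norm norm_minus_commute)
    have "f m - f b = (1 - t) *\<^sub>R (f a - f b)"
      by (simp add: m algebra_simps)
    then have d2: "dist (f m) (f b) = (1 - t) * d"
      using t by (simp add: d_def dist_norm)
    have small: "d / real (Suc n) < c * s"
      using Suc.prems by (simp add: d_def field_simps)
    have two: "c * dist m b \<le> dist (f m) (f b)"
      using small t by (intro step) (simp add: d2)
    have one: "c * dist a m \<le> dist (f a) (f m)"
    proof (cases "n = 0")
      case True
      then have "f a = f m" by (simp add: m t_def)
      then have "a = m" using inj by (simp add: inj_eq)
      then show ?thesis by simp
    next
      case False
      have "t * d = real n * (d / real (Suc n))" by (simp add: t_def)
      also have "\<dots> < real n * (c * s)" using small False by (intro mult_strict_left_mono) auto
      finally show ?thesis by (intro Suc.IH) (simp add: d1)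
    qed
    have "c * dist a b \<le> c * dist a m + c * dist m b"
      using \<open>0 < c\<close> dist_triangle[of a b m] by (simp flip: distrib_left)
    also have "\<dots> \<le> t * d + (1 - t) * d" using one two d1 d2 by linarith
    also have "\<dots> = d" by (simp add: algebra_simps)
    finally show ?case by (simp add: d_def)
  qed
  obtain n :: nat where "dist (f a) (f b) < real n * (c * s)"
    using cs by (metis reals_Archimedean3)
  then show ?thesis by (rule chain)
qed

section \<open>Bounds on partial derivatives\<close>

lemma linear_bound_Basis:
  fixes A :: "'a::euclidean_space \<Rightarrow> 'b::real_normed_vector"
  assumes "linear A" and C: "\<And>e. e \<in> Basis \<Longrightarrow> norm (A e) \<le> C e"
  shows "norm (A u) \<le> (\<Sum>e\<in>Basis. C e) * norm u"
proof -
  have "A u = A (\<Sum>e\<in>Basis. (u \<bullet> e) *\<^sub>R e)" by (simp add: euclidean_representation)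
  also have "\<dots> = (\<Sum>e\<in>Basis. (u \<bullet> e) *\<^sub>R A e)"
    using \<open>linear A\<close> by (simp add: linear_sum linear_scale)
  finally have "norm (A u) \<le> (\<Sum>e\<in>Basis. \<bar>u \<bullet> e\<bar> * norm (A e))"
    by (simp add: sum_norm_le)
  also have "\<dots> \<le> (\<Sum>e\<in>Basis. norm u * C e)"
    by (intro sum_mono mult_mono C Basis_le_norm) auto
  also have "\<dots> = (\<Sum>e\<in>Basis. C e) * norm u"
    by (subst sum_distrib_right) (simp add: mult.commute)
  finally show ?thesis .
qed

lemma bounded_partial_derivs_imp_bounded_derivative:
  fixes f :: "'a::euclidean_space \<Rightarrow> 'b::real_normed_vector"
  assumes diff: "\<And>z. f differentiable (at z)"
    and bdd: "\<And>e. e \<in> Basis \<Longrightarrow> \<exists>C. \<forall>z. norm (partial_deriv e f z) \<le> C"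
  obtains M where "M > 0" "\<And>z u. norm (frechet_derivative f (at z) u) \<le> M * norm u"
proof -
  obtain C where C: "\<And>e z. e \<in> Basis \<Longrightarrow> norm (partial_deriv e f z) \<le> C e"
    using bdd by metis
  let ?M = "max 1 (\<Sum>e\<in>Basis. C e)"
  have "norm (frechet_derivative f (at z) u) \<le> ?M * norm u" for z u
  proof -
    have "norm (frechet_derivative f (at z) u) \<le> (\<Sum>e\<in>Basis. C e) * norm u"
      using C by (intro linear_bound_Basis linear_frechet_derivative diff) (simp add: partial_deriv_def)
    also have "\<dots> \<le> ?M * norm u" by (intro mult_right_mono) auto
    finally show ?thesis .
  qed
  then show ?thesis by (rule that[of ?M, rotated]) auto
qed

lemma bounded_partial_derivs_imp_Lipschitz:
  fixes f :: "'a::euclidean_space \<Rightarrow> 'b::real_normed_vector"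
  assumes diff: "\<And>z. f differentiable (at z)"
    and bdd: "\<And>e. e \<in> Basis \<Longrightarrow> \<exists>C. \<forall>z. norm (partial_deriv e f z) \<le> C"
  shows "\<exists>L. \<forall>z w. norm (f z - f w) \<le> L * norm (z - w)"
proof -
  obtain M where M: "M > 0" "\<And>z u. norm (frechet_derivative f (at z) u) \<le> M * norm u"
    using bounded_partial_derivs_imp_bounded_derivative[OF diff bdd] by blast
  have "norm (f z - f w) \<le> M * norm (z - w)" for z w
  proof (rule differentiable_bound[OF convex_UNIV])
    show "(f has_derivative frechet_derivative f (at x)) (at x within UNIV)" for x
      using diff frechet_derivative_works by auto
    show "onorm (frechet_derivative f (at x)) \<le> M" for x
      by (rule onorm_le) (rule M)
  qed auto
  then show ?thesis by blast
qed

text \<open>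
  The bounds make each \<open>\<lambda>z. Df(z) e\<close> Lipschitz, hence \<open>Df\<close> Lipschitz in operator norm; the constant
  \<open>K\<close> is the same at every base point, which is what makes the scale in the expansion estimate uniform.
\<close>

lemma bounded_second_partial_derivs_imp_linearization:
  fixes f :: "'a::euclidean_space \<Rightarrow> 'b::real_normed_vector"
  assumes diff: "\<And>z. f differentiable (at z)"
    and diff2: "\<And>e z. e \<in> Basis \<Longrightarrow> partial_deriv e f differentiable (at z)"
    and bdd2: "\<And>e e'. e \<in> Basis \<Longrightarrow> e' \<in> Basis \<Longrightarrow>
                 \<exists>C. \<forall>z. norm (partial_deriv e' (partial_deriv e f) z) \<le> C"
  obtains K where "K > 0"
    "\<And>a b. norm (f b - f a - frechet_derivative f (at a) (b - a)) \<le> K * (norm (b - a))\<^sup>2"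
proof -
  have "\<exists>L. \<forall>z w. norm (partial_deriv e f z - partial_deriv e f w) \<le> L * norm (z - w)"
    if "e \<in> Basis" for e
    using bounded_partial_derivs_imp_Lipschitz diff2[OF that] bdd2[OF that] by blast
  then obtain L where L:
    "\<And>e z w. e \<in> Basis \<Longrightarrow> norm (partial_deriv e f z - partial_deriv e f w) \<le> L e * norm (z - w)"
    by metis
  define K where "K = max 1 (\<Sum>e\<in>Basis. L e)"
  let ?D = "\<lambda>z. frechet_derivative f (at z)"
  have der: "norm (?D z u - ?D w u) \<le> K * norm (z - w) * norm u" for z w u
  proof -
    have "norm (?D z u - ?D w u) \<le> (\<Sum>e\<in>Basis. L e * norm (z - w)) * norm u"
      using L by (intro linear_bound_Basis[where A = "\<lambda>u. ?D z u - ?D w u"]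
          linear_compose_sub linear_frechet_derivative diff) (simp add: partial_deriv_def)
    also have "\<dots> = (\<Sum>e\<in>Basis. L e) * (norm (z - w) * norm u)"
      by (simp add: sum_distrib_right mult.assoc)
    also have "\<dots> \<le> K * (norm (z - w) * norm u)"
      by (intro mult_right_mono) (auto simp: K_def)
    finally show ?thesis by (simp add: mult.assoc)
  qed
  have "norm (f b - f a - ?D a (b - a)) \<le> K * (norm (b - a))\<^sup>2" for a b
  proof -
    have "norm (f b - f a - ?D a (b - a)) \<le> norm (b - a) * (K * norm (b - a))"
    proof (rule differentiable_bound_linearization[where S = "closed_segment a b" and f' = ?D])
      show "a + t *\<^sub>R (b - a) \<in> closed_segment a b" if "t \<in> {0..1}" for t
        using that by (auto simp: closed_segment_def algebra_simps intro!: exI[of _ t])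
      show "(f has_derivative ?D x) (at x within closed_segment a b)" for x
        using diff frechet_derivative_works has_derivative_at_withinI by blast
      show "onorm (?D x - ?D a) \<le> K * norm (b - a)" if "x \<in> closed_segment a b" for x
      proof (rule onorm_le)
        fix u :: 'a
        have "norm (x - a) \<le> norm (b - a)" using segment_bound(1)[OF that] .
        then have "K * norm (x - a) * norm u \<le> K * norm (b - a) * norm u"
          by (intro mult_right_mono mult_left_mono) (auto simp: K_def)
        with der[of x u a] show "norm ((?D x - ?D a) u) \<le> K * norm (b - a) * norm u"
          by simp
      qed
    qed auto
    then show ?thesis by (simp add: power2_eq_square ac_simps)
  qed
  moreover have "K > 0" by (simp add: K_def)
  ultimately show ?thesis using that by blast
qed

section \<open>Tame canonical transformations expand distances\<close>

text \<open>Pairing \<open>A u\<close> with the image of \<open>J u = (- snd u, fst u)\<close> recovers \<open>|u|\<^sup>2\<close>, up to sign.\<close>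

lemma symplectic_form_preserving_lower_bound:
  fixes A :: "(real^'n) \<times> (real^'n) \<Rightarrow> (real^'n) \<times> (real^'n)"
  assumes pres: "\<And>u v. symplectic_form (A u) (A v) = symplectic_form u v"
    and bound: "\<And>u. norm (A u) \<le> M * norm u"
  shows "norm u \<le> M * norm (A u)"
proof (cases "u = 0")
  case True
  have "norm (A 0) = 0" using bound[of 0] by simp
  then show ?thesis using True by simp
next
  case False
  define v where "v = (- snd u, fst u)"
  have nv: "norm v = norm u" by (simp add: v_def norm_prod_def add.commute)
  have form_le: "symplectic_form a b \<le> norm a * norm b" for a b :: "(real^'n) \<times> (real^'n)"
  proof -
    have "symplectic_form a b = a \<bullet> (snd b, - fst b)"
      by (simp add: symplectic_form_def inner_prod_def inner_commute)
    also have "\<dots> \<le> norm a * norm (snd b, - fst b)" by (rule norm_cauchy_schwarz)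
    also have "norm (snd b, - fst b) = norm b" by (simp add: norm_prod_def add.commute)
    finally show ?thesis .
  qed
  have "norm u * norm u = symplectic_form u v"
    by (simp add: symplectic_form_def v_def norm_prod_def power2_norm_eq_inner)
  also have "\<dots> = symplectic_form (A u) (A v)" by (simp add: pres)
  also have "\<dots> \<le> norm (A u) * norm (A v)" by (rule form_le)
  also have "\<dots> \<le> norm (A u) * (M * norm u)"
    using bound[of v] nv by (intro mult_left_mono) auto
  finally have "norm u * norm u \<le> (M * norm (A u)) * norm u" by (simp add: ac_simps)
  then show ?thesis using False by simp
qed

lemma tame_canonical_differentiable:
  fixes chi :: "(real^'n) \<times> (real^'n) \<Rightarrow> (real^'n) \<times> (real^'n)"
  assumes "tame_canonical chi"
  shows "chi differentiable (at z)"
proof -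
  have "set [] \<subseteq> (Basis :: ((real^'n) \<times> (real^'n)) set)" by simp
  then have "iter_partial [] chi differentiable (at z)"
    using assms unfolding tame_canonical_def smooth_map_def by blast
  then show ?thesis by simp
qed

lemma tame_canonical_locally_expanding:
  fixes chi :: "(real^'n) \<times> (real^'n) \<Rightarrow> (real^'n) \<times> (real^'n)"
  assumes tame: "tame_canonical chi"
  obtains c r where "0 < c" "0 < r"
    "\<And>a b. dist a b \<le> r \<Longrightarrow> c * dist a b \<le> dist (chi a) (chi b)"
proof -
  let ?D = "\<lambda>z. frechet_derivative chi (at z)"
  note diff = tame_canonical_differentiable[OF tame]
  have smooth: "\<And>es z. set es \<subseteq> Basis \<Longrightarrow> iter_partial es chi differentiable (at z)"
    and bdd: "\<And>es. set es \<subseteq> Basis \<Longrightarrow> length es \<ge> 1 \<Longrightarrow> \<exists>C. \<forall>z. norm (iter_partial es chi z) \<le> C"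
    and canonical: "\<And>z u v. symplectic_form (?D z u) (?D z v) = symplectic_form u v"
    using tame by (auto simp: tame_canonical_def smooth_map_def canonical_map_def)
  have bdd1: "\<exists>C. \<forall>z. norm (partial_deriv e chi z) \<le> C" if "e \<in> Basis" for e
    using bdd[of "[e]"] that by simp
  have diff1: "partial_deriv e chi differentiable (at z)" if "e \<in> Basis" for e z
    using smooth[of "[e]"] that by simp
  have bdd2: "\<exists>C. \<forall>z. norm (partial_deriv e' (partial_deriv e chi) z) \<le> C"
    if "e \<in> Basis" "e' \<in> Basis" for e e'
    using bdd[of "[e', e]"] that by simp
  obtain M where M: "M > 0" "\<And>z u. norm (?D z u) \<le> M * norm u"
    using bounded_partial_derivs_imp_bounded_derivative[OF diff bdd1] by blast
  obtain K where K: "K > 0"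
    "\<And>a b. norm (chi b - chi a - ?D a (b - a)) \<le> K * (norm (b - a))\<^sup>2"
    using bounded_second_partial_derivs_imp_linearization[OF diff diff1 bdd2] by blast
  \<comment> \<open>At this scale the quadratic remainder is at most half of the lower bound for the linear part.\<close>
  define r where "r = 1 / (2 * M * K)"
  have "1 / (2 * M) * dist a b \<le> dist (chi a) (chi b)" if "dist a b \<le> r" for a b
  proof -
    let ?n = "norm (b - a)"
    have n: "?n = dist a b" by (simp add: dist_norm norm_minus_commute)
    have "?n \<le> M * norm (?D a (b - a))"
      by (rule symplectic_form_preserving_lower_bound[OF canonical M(2)])
    then have low: "?n / M \<le> norm (?D a (b - a))"
      using M(1) by (simp add: field_simps)
    have "K * ?n \<le> K * r" using that n K(1) by simp
    also have "K * r = 1 / (2 * M)" using K(1) by (simp add: r_def)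
    finally have "K * ?n * ?n \<le> 1 / (2 * M) * ?n"
      by (intro mult_right_mono) auto
    then have "norm (chi b - chi a - ?D a (b - a)) \<le> ?n / (2 * M)"
      using K(2)[of b a] by (simp add: power2_eq_square mult.assoc)
    moreover have "norm (?D a (b - a)) - norm (chi b - chi a)
                     \<le> norm (chi b - chi a - ?D a (b - a))"
      by (metis norm_minus_commute norm_triangle_ineq2)
    moreover have "?n / M - ?n / (2 * M) = ?n / (2 * M)"
      using M(1) by (simp add: field_simps)
    ultimately have "?n / (2 * M) \<le> norm (chi b - chi a)" using low by linarith
    then show ?thesis by (simp add: dist_norm norm_minus_commute)
  qed
  moreover have "0 < 1 / (2 * M)" "0 < r" using M(1) K(1) by (auto simp: r_def)
  ultimately show ?thesis using that by blast
qed

lemma tame_canonical_expanding: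
  fixes chi :: "(real^'n) \<times> (real^'n) \<Rightarrow> (real^'n) \<times> (real^'n)"
  assumes tame: "tame_canonical chi"
  obtains c where "0 < c" "\<And>a b. c * dist a b \<le> dist (chi a) (chi b)"
proof -
  have "continuous_on UNIV chi"
    using tame_canonical_differentiable[OF tame]
    by (simp add: continuous_on_eq_continuous_at differentiable_imp_continuous_within)
  then show ?thesis
    using tame_canonical_locally_expanding[OF tame] locally_expanding_imp_expanding that by metis
qed

section \<open>Stability of the vertical nonrefocusing condition\<close>

text \<open>Compactness of the unit sphere gives a uniform aperture, and homogeneity extends it to all \<open>\<xi>\<close>.\<close>

lemma pos_conic_contains_vertical_cone:
  fixes \<Gamma> :: "('a::real_normed_vector \<times> 'b::euclidean_space) set"
  assumes "open \<Gamma>" "pos_conic \<Gamma>" "{0} \<times> (UNIV - {0}) \<subseteq> \<Gamma>"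
  obtains \<delta> where "\<delta> > 0" "\<And>z \<xi>. norm (z - (0, \<xi>)) < \<delta> * norm \<xi> \<Longrightarrow> z \<in> \<Gamma>"
proof -
  have "compact ({0::'a} \<times> sphere (0::'b) 1)"
    by (intro compact_Times compact_sing compact_sphere)
  moreover have "{0} \<times> sphere 0 1 \<subseteq> \<Gamma>"
  proof (rule subset_trans[OF _ assms(3)])
    show "{0::'a} \<times> sphere (0::'b) 1 \<subseteq> {0} \<times> (UNIV - {0})" by fastforce
  qed
  ultimately obtain \<delta> where \<delta>: "\<delta> > 0" "(\<Union>w\<in>{0} \<times> sphere 0 1. ball w \<delta>) \<subseteq> \<Gamma>"
    by (rule compact_subset_open_imp_ball_epsilon_subset[OF _ \<open>open \<Gamma>\<close>])
  have "z \<in> \<Gamma>" if z: "norm (z - (0, \<xi>)) < \<delta> * norm \<xi>" for z \<xi>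
  proof -
    have pos: "norm \<xi> > 0" using z by (cases "\<xi> = 0") auto
    define w where "w = (1 / norm \<xi>) *\<^sub>R z"
    have "(0, (1 / norm \<xi>) *\<^sub>R \<xi>) - w = (1 / norm \<xi>) *\<^sub>R ((0, \<xi>) - z)"
      by (simp add: w_def scaleR_diff_right)
    then have "dist (0, (1 / norm \<xi>) *\<^sub>R \<xi>) w = norm (z - (0, \<xi>)) / norm \<xi>"
      by (simp add: dist_norm norm_minus_commute)
    also have "\<dots> < \<delta>" using z pos by (simp add: field_simps)
    finally have "w \<in> ball (0, (1 / norm \<xi>) *\<^sub>R \<xi>) \<delta>" by simp
    moreover have "(0, (1 / norm \<xi>) *\<^sub>R \<xi>) \<in> {0} \<times> sphere 0 1" using pos by simp
    ultimately have "w \<in> \<Gamma>" using \<delta>(2) by blast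
    then have "norm \<xi> *\<^sub>R w \<in> \<Gamma>" using \<open>pos_conic \<Gamma>\<close> pos by (simp add: pos_conic_def)
    then show ?thesis using pos by (simp add: w_def)
  qed
  then show ?thesis using that \<delta>(1) by blast
qed

theorem proposition3p3:
  fixes chi chi' :: "(real^'n) \<times> (real^'n) \<Rightarrow> (real^'n) \<times> (real^'n)"
  assumes "tame_canonical chi" and "tame_canonical chi'"
    and "((\<lambda>\<eta>. norm (chi (0, \<eta>) - chi' (0, \<eta>)) / norm \<eta>) \<longlongrightarrow> 0) at_infinity"
    and "vertical_nonrefocusing chi"
  shows "vertical_nonrefocusing chi'"
proof -
  obtain \<Gamma> R where G: "open \<Gamma>" "pos_conic \<Gamma>" "{0} \<times> (UNIV - {0}) \<subseteq> \<Gamma>"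
    and R: "\<And>\<eta>. norm \<eta> > R \<Longrightarrow> chi (0, \<eta>) \<notin> \<Gamma>"
    using assms(4) unfolding vertical_nonrefocusing_def by blast
  obtain \<delta>0 where \<delta>0: "\<delta>0 > 0" "\<And>z \<xi>. norm (z - (0, \<xi>)) < \<delta>0 * norm \<xi> \<Longrightarrow> z \<in> \<Gamma>"
    using pos_conic_contains_vertical_cone[OF G] by blast
  obtain c where c: "0 < c" "\<And>a b. c * dist a b \<le> dist (chi' a) (chi' b)"
    using tame_canonical_expanding[OF assms(2)] by blast
  define \<delta> where "\<delta> = min 1 (\<delta>0 / 2)"
  have \<delta>: "\<delta> > 0" "\<delta> \<le> 1" "\<delta> \<le> \<delta>0 / 2" using \<delta>0(1) by (auto simp: \<delta>_def)
  \<comment> \<open>Chosen so that, with \<open>c |\<eta>| \<le> 4 |\<xi>|\<close> as shown below, \<open>\<epsilon> |\<eta>| \<le> \<delta>0 |\<xi>| / 4\<close>.\<close>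
  define \<epsilon> where "\<epsilon> = c * \<delta>0 / 16"
  have "\<epsilon> > 0" using c(1) \<delta>0(1) by (simp add: \<epsilon>_def)
  from tendstoD[OF assms(3) this] obtain B where
    B: "\<And>\<eta>. B \<le> norm \<eta> \<Longrightarrow> norm (chi (0, \<eta>) - chi' (0, \<eta>)) / norm \<eta> < \<epsilon>"
    by (auto simp: eventually_at_infinity)
  define R' where "R' = max 1 (max R (max B (2 * norm (chi' 0) / c)))"
  define \<Gamma>' :: "((real^'n) \<times> (real^'n)) set"
    where "\<Gamma>' = {z. norm (fst z) < \<delta> * norm (snd z)}"
  have "chi' (0, \<eta>) \<notin> \<Gamma>'" if "norm \<eta> > R'" for \<eta>
  proof
    assume *: "chi' (0, \<eta>) \<in> \<Gamma>'"
    have big: "norm \<eta> > 0" "norm \<eta> > R" "norm \<eta> \<ge> B" "2 * norm (chi' 0) / c < norm \<eta>"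
      using that by (auto simp: R'_def)
    obtain x \<xi> where x\<xi>: "chi' (0, \<eta>) = (x, \<xi>)" by fastforce
    have x: "norm x < \<delta> * norm \<xi>" using * by (simp add: \<Gamma>'_def x\<xi>)
    have "c * norm \<eta> \<le> norm (chi' (0, \<eta>) - chi' 0)"
      using c(2)[of "(0, \<eta>)" 0] by (simp add: dist_norm norm_Pair)
    also have "\<dots> \<le> norm (x, \<xi>) + norm (chi' 0)"
      using norm_triangle_ineq4 x\<xi> by metis
    also have "\<dots> \<le> norm x + norm \<xi> + norm (chi' 0)"
      using norm_Pair_le[of x \<xi>] by simp
    finally have "c * norm \<eta> \<le> norm x + norm \<xi> + norm (chi' 0)" .
    moreover have "2 * norm (chi' 0) \<le> c * norm \<eta>"
      using big(4) c(1) by (simp add: field_simps)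
    moreover have "norm x \<le> norm \<xi>"
      using x mult_right_mono[OF \<delta>(2) norm_ge_zero[of \<xi>]] by simp
    ultimately have \<eta>: "c * norm \<eta> \<le> 4 * norm \<xi>" by linarith
    have \<xi>: "norm \<xi> > 0" using x by (cases "\<xi> = 0") auto
    have "norm (chi (0, \<eta>) - chi' (0, \<eta>)) < \<epsilon> * norm \<eta>"
      using B[OF big(3)] big(1) by (simp add: field_simps)
    also have "\<dots> = \<delta>0 / 16 * (c * norm \<eta>)" by (simp add: \<epsilon>_def)
    also have "\<dots> \<le> \<delta>0 / 16 * (4 * norm \<xi>)"
      using \<eta> \<delta>0(1) by (intro mult_left_mono) auto
    finally have diff: "norm (chi (0, \<eta>) - chi' (0, \<eta>)) < \<delta>0 * norm \<xi> / 4" by simp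
    have "norm (chi' (0, \<eta>) - (0, \<xi>)) = norm x" by (simp add: x\<xi> norm_Pair)
    also have "\<dots> \<le> \<delta>0 * norm \<xi> / 2"
      using x mult_right_mono[OF \<delta>(3) norm_ge_zero[of \<xi>]] by simp
    finally have near: "norm (chi' (0, \<eta>) - (0, \<xi>)) \<le> \<delta>0 * norm \<xi> / 2" .
    have "norm (chi (0, \<eta>) - (0, \<xi>))
            \<le> norm (chi (0, \<eta>) - chi' (0, \<eta>)) + norm (chi' (0, \<eta>) - (0, \<xi>))"
      by (rule norm_diff_triangle_le) auto
    also have "\<dots> < \<delta>0 * norm \<xi> / 4 + \<delta>0 * norm \<xi> / 2"
      using diff near by (rule add_less_le_mono)
    also have "\<dots> \<le> \<delta>0 * norm \<xi>" using \<delta>0(1) \<xi> by simp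
    finally have "chi (0, \<eta>) \<in> \<Gamma>" by (rule \<delta>0(2))
    then show False using R big(2) by blast
  qed
  moreover have "open \<Gamma>'"
    unfolding \<Gamma>'_def by (intro open_Collect_less continuous_intros)
  moreover have "pos_conic \<Gamma>'"
    by (auto simp: pos_conic_def \<Gamma>'_def mult.left_commute)
  moreover have "\<Gamma>' \<subseteq> UNIV - {0}" by (auto simp: \<Gamma>'_def)
  moreover have "{0} \<times> (UNIV - {0}) \<subseteq> \<Gamma>'" using \<delta>(1) by (auto simp: \<Gamma>'_def zero_less_mult_iff)
  moreover have "R' > 0" by (simp add: R'_def)
  ultimately show ?thesis unfolding vertical_nonrefocusing_def by blast
qed

end
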